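(* Let $\equiv$ be either $\equiv_{s,a}$ or $\equiv_{s,s}$. Let $T=\langle P,Q\rangle$ be an NSV-tuple, let $I_k$ be an independent set of $T$, let $a'\notin at(T)$ be a fresh atom, and let $T^\oplus=\langle P^\oplus,Q^\oplus\rangle$ be obtained from $T$ by adding $a'$ to $I_k$, and suppose $T^\oplus$ is also an NSV-tuple. Then $P\not\equiv Q$ implies $P^\oplus\not\equiv Q^\oplus$, and $P^\oplus\equiv Q^\oplus$ implies $P\equiv Q$.
   Context: Atoms are propositional. A rule $r$ is an expression $h_1\vee\cdots\vee h_k\leftarrow b_1,\dots,b_m,\mathit{not}\,c_1,\dots,\mathit{not}\,c_n$; write $H(r)$, $B^+(r)$, $B^-(r)$ for the sets of head, positive body and negative body atoms. An interpretation $X$ satisfies $r$ iff $X\cap H(r)\neq\emptyset$ or $B^+(r)\not\subseteq X$ or $B^-(r)\cap X\neq\emptyset$. GL-reduct $P^X=\{H(r)\leftarrow B^+(r) : r\in P,\ B^-(r)\cap X=\emptyset\}$; $X$ is an ASP stable model of a program $P$ iff $X\models P^X$ and no proper subset of $X$ satisfies $P^X$; $X$ is an LP$^{\mathrm{MLN}}$ stable model of $P$ (weights omitted) iff $X$ is an ASP stable model of $\{r\in P: X\models r\}$. $P\equiv_{s,a}Q$ (resp. $P\equiv_{s,s}Q$) iff for every program $R$, $P\cup R$ and $Q\cup R$ have the same ASP (resp. LP$^{\mathrm{MLN}}$) stable models. Programs are regarded as tuples of rules; $\langle P,Q\rangle$ is the concatenation, and a result tuple is split into its first $|P|$ rules and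 the rest. For a tuple $T=\langle r_1,\dots,r_n\rangle$ with atom set $at(T)$ let $\langle S_1,\dots,S_{3n}\rangle=\langle H(r_1),B^+(r_1),B^-(r_1),\dots,H(r_n),B^+(r_n),B^-(r_n)\rangle$; for nonempty $N'\subseteq\{1,\dots,3n\}$ the independent set is $I_{N'}=\bigcap_{i\in N'}S_i\setminus\bigcup_{j\notin N'}S_j$. Adding a fresh atom $a'$ to $I_{N'}$ means adding $a'$ to each $S_i$, $i\in N'$. $T$ is singleton if every nonempty independent set of $T$ has exactly one element. $T$ is an NSV-tuple if it is singleton and every rule $r$ of $T$ satisfies $B^+(r)\cap(H(r)\cup B^-(r))=\emptyset$. *)

theory Defs
  imports Main "HOL-Library.FSet"
begin

datatype 'a rule = Rule (head: "'a fset") (pos_body: "'a fset") (neg_body: "'a fset")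

definition sat_rule :: "'a set \<Rightarrow> 'a rule \<Rightarrow> bool" where
  "sat_rule X r \<longleftrightarrow>
     X \<inter> fset (head r) \<noteq> {} \<or> \<not> fset (pos_body r) \<subseteq> X \<or> fset (neg_body r) \<inter> X \<noteq> {}"

definition sat_program :: "'a set \<Rightarrow> 'a rule set \<Rightarrow> bool" where
  "sat_program X P \<longleftrightarrow> (\<forall>r\<in>P. sat_rule X r)"

definition gl_reduct :: "'a rule set \<Rightarrow> 'a set \<Rightarrow> 'a rule set" where
  "gl_reduct P X = {Rule (head r) (pos_body r) {||} | r. r \<in> P \<and> fset (neg_body r) \<inter> X = {}}"

definition asp_stable_model :: "'a rule set \<Rightarrow> 'a set \<Rightarrow> bool" where
  "asp_stable_model P X \<longleftrightarrow>
     sat_program X (gl_reduct P X) \<and> (\<forall>Y. Y \<subset> X \<longrightarrow> \<not> sat_program Y (gl_reduct P X))"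

definition lpmln_stable_model :: "'a rule set \<Rightarrow> 'a set \<Rightarrow> bool" where
  "lpmln_stable_model P X \<longleftrightarrow> asp_stable_model {r \<in> P. sat_rule X r} X"

text \<open>A program is a finite set of rules; hence the context program \<open>R\<close> ranges over finite sets.\<close>

definition strongly_equiv_asp :: "'a rule set \<Rightarrow> 'a rule set \<Rightarrow> bool" where
  "strongly_equiv_asp P Q \<longleftrightarrow>
     (\<forall>R. finite R \<longrightarrow> {X. asp_stable_model (P \<union> R) X} = {X. asp_stable_model (Q \<union> R) X})"

definition strongly_equiv_lpmln :: "'a rule set \<Rightarrow> 'a rule set \<Rightarrow> bool" where
  "strongly_equiv_lpmln P Q \<longleftrightarrow>
     (\<forall>R. finite R \<longrightarrow> {X. lpmln_stable_model (P \<union> R) X} = {X. lpmln_stable_model (Q \<union> R) X})"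

definition atoms_of :: "'a rule list \<Rightarrow> 'a set" where
  "atoms_of T = (\<Union>r\<in>set T. fset (head r) \<union> fset (pos_body r) \<union> fset (neg_body r))"

text \<open>Positions are counted from 0: the head, positive body and negative body of the rule
  \<open>T ! i\<close> are the components \<open>3 * i\<close>, \<open>3 * i + 1\<close> and \<open>3 * i + 2\<close>.\<close>

definition components :: "'a rule list \<Rightarrow> 'a set list" where
  "components T = concat (map (\<lambda>r. [fset (head r), fset (pos_body r), fset (neg_body r)]) T)"

definition independent_set :: "'a rule list \<Rightarrow> nat set \<Rightarrow> 'a set" where
  "independent_set T N =
     (\<Inter>i\<in>N. components T ! i) - (\<Union>j\<in>{..<3 * length T} - N. components T ! j)"

definition add_atom :: "'a \<Rightarrow> nat set \<Rightarrow> 'a rule list \<Rightarrow> 'a rule list" where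
  "add_atom a N T =
     map (\<lambda>i. Rule
            (if 3 * i \<in> N then finsert a (head (T ! i)) else head (T ! i))
            (if 3 * i + 1 \<in> N then finsert a (pos_body (T ! i)) else pos_body (T ! i))
            (if 3 * i + 2 \<in> N then finsert a (neg_body (T ! i)) else neg_body (T ! i)))
       [0..<length T]"

definition singleton_tuple :: "'a rule list \<Rightarrow> bool" where
  "singleton_tuple T \<longleftrightarrow>
     (\<forall>N. N \<noteq> {} \<and> N \<subseteq> {..<3 * length T} \<and> independent_set T N \<noteq> {} \<longrightarrow>
        card (independent_set T N) = 1)"

definition nsv_tuple :: "'a rule list \<Rightarrow> bool" where
  "nsv_tuple T \<longleftrightarrow> singleton_tuple T \<and>
     (\<forall>r\<in>set T. fset (pos_body r) \<inter> (fset (head r) \<union> fset (neg_body r)) = {})"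

lemma length_components: "length (components T) = 3 * length T"
  by (induction T) (auto simp: components_def)

lemma components_nth:
  assumes "i < length T"
  shows "components T ! (3 * i) = fset (head (T ! i))"
    and "components T ! (3 * i + 1) = fset (pos_body (T ! i))"
    and "components T ! (3 * i + 2) = fset (neg_body (T ! i))"
  using assms
proof (induction T arbitrary: i)
  case (Cons r T)
  { case 1 then show ?case using Cons.IH(1)[of "i - 1"]
      by (cases i) (auto simp: components_def numeral_3_eq_3) }
  { case 2 then show ?case using Cons.IH(2)[of "i - 1"]
      by (cases i) (auto simp: components_def numeral_3_eq_3) }
  { case 3 then show ?case using Cons.IH(3)[of "i - 1"]
      by (cases i) (auto simp: components_def numeral_3_eq_3) }
qed auto

lemma length_add_atom: "length (add_atom a N T) = length T"
  by (simp add: add_atom_def)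

lemma components_add_atom:
  assumes "i < 3 * length T"
  shows "components (add_atom a N T) ! i =
    (if i \<in> N then insert a (components T ! i) else components T ! i)"
proof -
  define k where "k = i div 3"
  have k: "k < length T" using assms by (simp add: k_def less_mult_imp_div_less mult.commute)
  have "i = 3 * k \<or> i = 3 * k + 1 \<or> i = 3 * k + 2" unfolding k_def by presburger
  then show ?thesis
    using components_nth[OF k] components_nth[of k "add_atom a N T"] k
    by (elim disjE) (simp_all add: add_atom_def)
qed

end

theory Submission
  imports Defs
begin

text \<open>Both equivalences are characterised by pairs \<open>X \<subseteq> Y\<close> (here-and-there interpretations): whether
  \<open>P\<close> and \<open>Q\<close> are equivalent is decided by rule-wise satisfaction at \<open>(Y, Y)\<close> and \<open>(X, Y)\<close>. Let
  \<open>(X, Y)\<close> over the atoms of the original programs be a model of \<open>P\<close> that violates a rule \<open>r\<close> of \<open>Q\<close>.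
  Making \<open>a'\<close> false in both components satisfies every rule with \<open>a'\<close> in its positive body and leaves
  all other rules as they were; making it true in both components satisfies every rule with \<open>a'\<close> in
  its head or negative body and leaves all others as they were. Either way \<open>P\<^sup>\<oplus>\<close> stays satisfied, and
  since \<open>a'\<close> cannot occur in the positive body of \<open>r\<^sup>\<oplus>\<close> together with another part of it, one of the
  two choices still violates \<open>r\<^sup>\<oplus>\<close>.\<close>

text \<open>This is satisfaction by \<open>X\<close> of the reduct of \<open>r\<close> with respect
  to \<open>Y\<close>. A rule that the reduct deletes counts as satisfied, so reducts need not be
  built.\<close>

definition here_sat :: "'a set \<Rightarrow> 'a set \<Rightarrow> 'a rule \<Rightarrow> bool" where
  "here_sat X Y r \<longleftrightarrow>
     X \<inter> fset (head r) \<noteq> {} \<or> \<not> fset (pos_body r) \<subseteq> X \<or> fset (neg_body r) \<inter> Y \<noteq> {}"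

text \<open>The connective \<open>c\<close> is \<open>(\<and>)\<close> for ASP, which gives the usual SE-models, and \<open>(\<longrightarrow>)\<close> for
  LPMLN, where rules violated by \<open>Y\<close> are dropped.\<close>

definition ht_model :: "(bool \<Rightarrow> bool \<Rightarrow> bool) \<Rightarrow> 'a rule set \<Rightarrow> 'a set \<Rightarrow> 'a set \<Rightarrow> bool" where
  "ht_model c P X Y \<longleftrightarrow> (\<forall>r\<in>P. c (here_sat Y Y r) (here_sat X Y r))"

text \<open>\<open>Y\<close> is an arbitrary set, as for stable models, whereas separating contexts
  require finite \<open>Y\<close>; \<open>ht_model_restrict\<close> bridges the gap.\<close>

definition ht_equiv :: "(bool \<Rightarrow> bool \<Rightarrow> bool) \<Rightarrow> 'a rule set \<Rightarrow> 'a rule set \<Rightarrow> bool" where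
  "ht_equiv c P Q \<longleftrightarrow> (\<forall>X Y. X \<subseteq> Y \<longrightarrow> ht_model c P X Y = ht_model c Q X Y)"

lemma sat_rule_iff_here_sat: "sat_rule Y r \<longleftrightarrow> here_sat Y Y r"
  by (simp add: sat_rule_def here_sat_def)

lemma sat_gl_reduct_iff: "sat_program X (gl_reduct P Y) \<longleftrightarrow> (\<forall>r\<in>P. here_sat X Y r)"
proof -
  have "gl_reduct P Y =
      (\<lambda>r. Rule (head r) (pos_body r) {||}) ` {r \<in> P. fset (neg_body r) \<inter> Y = {}}"
    by (auto simp: gl_reduct_def)
  then show ?thesis
    by (auto simp: sat_program_def sat_rule_def here_sat_def)
qed

lemma ht_model_Un: "ht_model c (P \<union> R) X Y \<longleftrightarrow> ht_model c P X Y \<and> ht_model c R X Y"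
  by (auto simp: ht_model_def)

lemma asp_stable_model_iff:
  "asp_stable_model P Y \<longleftrightarrow>
     ht_model (\<and>) P Y Y \<and> (\<forall>X. X \<subset> Y \<longrightarrow> \<not> ht_model (\<and>) P X Y)"
  unfolding asp_stable_model_def sat_gl_reduct_iff ht_model_def by blast

text \<open>With \<open>(\<longrightarrow>)\<close> the condition at \<open>(Y, Y)\<close> is a
  tautology. The form agrees with the ASP case, so one separation argument serves both
  semantics.\<close>

lemma lpmln_stable_model_iff:
  "lpmln_stable_model P Y \<longleftrightarrow>
     ht_model (\<longrightarrow>) P Y Y \<and> (\<forall>X. X \<subset> Y \<longrightarrow> \<not> ht_model (\<longrightarrow>) P X Y)"
  unfolding lpmln_stable_model_def asp_stable_model_def sat_gl_reduct_iff ht_model_def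
    sat_rule_iff_here_sat by blast

lemma ht_equiv_imp_strongly_equiv_asp: "ht_equiv (\<and>) P Q \<Longrightarrow> strongly_equiv_asp P Q"
  by (simp add: ht_equiv_def strongly_equiv_asp_def asp_stable_model_iff ht_model_Un psubset_eq)

lemma ht_equiv_imp_strongly_equiv_lpmln: "ht_equiv (\<longrightarrow>) P Q \<Longrightarrow> strongly_equiv_lpmln P Q"
  by (simp add: ht_equiv_def strongly_equiv_lpmln_def lpmln_stable_model_iff ht_model_Un psubset_eq)

text \<open>The context separating \<open>(X, Y)\<close> from all other subsets of \<open>Y\<close>: its models below \<open>Y\<close> are
  exactly \<open>X\<close> and \<open>Y\<close>.\<close>

definition separating_context :: "'a set \<Rightarrow> 'a set \<Rightarrow> 'a rule set" where
  "separating_context X Y =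
     (\<lambda>x. Rule {|x|} {||} {||}) ` X \<union>
     (\<lambda>(y, z). Rule {|y|} {|z|} {||}) ` ((Y - X) \<times> (Y - X))"

lemma finite_separating_context: "finite X \<Longrightarrow> finite Y \<Longrightarrow> finite (separating_context X Y)"
  by (simp add: separating_context_def)

lemma ht_model_separating_context:
  assumes "X \<subseteq> Y" "Z \<subseteq> Y" "c = (\<and>) \<or> c = (\<longrightarrow>)"
  shows "ht_model c (separating_context X Y) Z Y \<longleftrightarrow> Z = X \<or> Z = Y"
proof -
  \<comment> \<open>Hence either connective reduces to satisfaction at
    \<open>(Z, Y)\<close>.\<close>
  have "here_sat Y Y r" if "r \<in> separating_context X Y" for r
    using that assms(1) by (auto simp: separating_context_def here_sat_def)
  then have "ht_model c (separating_context X Y) Z Y \<longleftrightarrow>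
      (\<forall>r\<in>separating_context X Y. here_sat Z Y r)"
    using assms(3) by (auto simp: ht_model_def)
  also have "\<dots> \<longleftrightarrow> X \<subseteq> Z \<and> (\<forall>y\<in>Y - X. \<forall>z\<in>Y - X. z \<in> Z \<longrightarrow> y \<in> Z)"
    unfolding separating_context_def ball_Un ball_simps here_sat_def by auto
  also have "\<dots> \<longleftrightarrow> Z = X \<or> Z = Y"
    using assms(1,2) by blast
  finally show ?thesis .
qed

text \<open>The two contexts are \<open>separating_context Y Y\<close> (the facts of \<open>Y\<close>), which compares the total models, and
  \<open>separating_context X Y\<close>.\<close>

lemma ht_model_transfer_by_contexts:
  assumes c: "c = (\<and>) \<or> c = (\<longrightarrow>)"
    and same: "\<And>R. finite R \<Longrightarrow>
      (ht_model c (P \<union> R) Y Y \<and> (\<forall>X. X \<subset> Y \<longrightarrow> \<not> ht_model c (P \<union> R) X Y)) =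
      (ht_model c (Q \<union> R) Y Y \<and> (\<forall>X. X \<subset> Y \<longrightarrow> \<not> ht_model c (Q \<union> R) X Y))"
    and XY: "X \<subseteq> Y" "finite Y" and P: "ht_model c P X Y"
  shows "ht_model c Q X Y"
proof -
  have fin: "finite X" using XY by (rule finite_subset)
  have context_model: "ht_model c (separating_context V Y) Z Y \<longleftrightarrow> Z = V \<or> Z = Y"
    if "V \<subseteq> Y" "Z \<subseteq> Y" for V Z
    using ht_model_separating_context[OF that c] .
  have "ht_model c P Y Y"
    using P c by (auto simp: ht_model_def)
  \<comment> \<open>Under the facts of \<open>Y\<close> no proper subset of \<open>Y\<close>
    survives, so stability of \<open>Y\<close> amounts to the condition at
    \<open>(Y, Y)\<close>.\<close>
  then have QY: "ht_model c Q Y Y"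
    using same[OF finite_separating_context[OF XY(2) XY(2)]]
    by (auto simp: ht_model_Un context_model)
  show ?thesis
  proof (rule ccontr)
    let ?R = "separating_context X Y"
    assume notQ: "\<not> ht_model c Q X Y"
    with QY have "X \<subset> Y" using XY by blast
    \<comment> \<open>Strictly below \<open>Y\<close> the context admits only \<open>X\<close>,
      where \<open>Q\<close> fails. So \<open>Y\<close> is stable with \<open>Q\<close> and, by
      \<open>same\<close>, with \<open>P\<close>, although \<open>P\<close> holds at
      \<open>(X, Y)\<close>.\<close>
    have "ht_model c (Q \<union> ?R) Y Y"
      using QY XY(1) by (simp add: ht_model_Un context_model)
    moreover have "\<not> ht_model c (Q \<union> ?R) Z Y" if "Z \<subset> Y" for Z
      using notQ that XY(1) context_model[of X Z] by (auto simp: ht_model_Un)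
    ultimately have "\<not> ht_model c (P \<union> ?R) X Y"
      using same[OF finite_separating_context[OF fin XY(2)]] \<open>X \<subset> Y\<close> by blast
    then show False
      using P XY(1) by (simp add: ht_model_Un context_model)
  qed
qed

lemma strongly_equiv_asp_imp_ht_model_eq:
  assumes "strongly_equiv_asp P Q" "X \<subseteq> Y" "finite Y"
  shows "ht_model (\<and>) P X Y = ht_model (\<and>) Q X Y"
proof -
  have same: "asp_stable_model (P \<union> R) Y = asp_stable_model (Q \<union> R) Y" if "finite R" for R
    using assms(1) that unfolding strongly_equiv_asp_def by blast
  show ?thesis
    using ht_model_transfer_by_contexts[of "(\<and>)" P Y Q X]
      ht_model_transfer_by_contexts[of "(\<and>)" Q Y P X] same assms(2,3)
    unfolding asp_stable_model_iff by blast
qed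

lemma strongly_equiv_lpmln_imp_ht_model_eq:
  assumes "strongly_equiv_lpmln P Q" "X \<subseteq> Y" "finite Y"
  shows "ht_model (\<longrightarrow>) P X Y = ht_model (\<longrightarrow>) Q X Y"
proof -
  have same: "lpmln_stable_model (P \<union> R) Y = lpmln_stable_model (Q \<union> R) Y" if "finite R" for R
    using assms(1) that unfolding strongly_equiv_lpmln_def by blast
  show ?thesis
    using ht_model_transfer_by_contexts[of "(\<longrightarrow>)" P Y Q X]
      ht_model_transfer_by_contexts[of "(\<longrightarrow>)" Q Y P X] same assms(2,3)
    unfolding lpmln_stable_model_iff by blast
qed

lemma finite_atoms_of: "finite (atoms_of T)"
  by (simp add: atoms_of_def)

lemma ht_model_restrict:
  assumes "atoms_of T \<subseteq> A"
  shows "ht_model c (set T) (X \<inter> A) (Y \<inter> A) \<longleftrightarrow> ht_model c (set T) X Y"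
proof -
  have "here_sat (V \<inter> A) (W \<inter> A) r = here_sat V W r" if "r \<in> set T" for r V W
  proof -
    have "fset (head r) \<subseteq> A" "fset (pos_body r) \<subseteq> A" "fset (neg_body r) \<subseteq> A"
      using that assms by (auto simp: atoms_of_def)
    then have "V \<inter> A \<inter> fset (head r) = V \<inter> fset (head r)"
      "fset (pos_body r) \<subseteq> V \<inter> A \<longleftrightarrow> fset (pos_body r) \<subseteq> V"
      "fset (neg_body r) \<inter> (W \<inter> A) = fset (neg_body r) \<inter> W"
      by auto
    then show ?thesis by (simp add: here_sat_def)
  qed
  then show ?thesis by (simp add: ht_model_def)
qed

text \<open>Adding an atom depends on the position, so equal rules of a tuple may become different.
  Erasing it depends on the rule alone, and so survives the passage to sets of rules.\<close>

definition erases :: "'a \<Rightarrow> 'a rule \<Rightarrow> 'a rule \<Rightarrow> bool" where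
  "erases a r' r \<longleftrightarrow> fset (head r) = fset (head r') - {a} \<and>
     fset (pos_body r) = fset (pos_body r') - {a} \<and> fset (neg_body r) = fset (neg_body r') - {a}"

lemma here_sat_erases_false:
  assumes "erases a r' r" "a \<notin> X" "a \<notin> Y"
  shows "here_sat X Y r' \<longleftrightarrow> a |\<in>| pos_body r' \<or> here_sat X Y r"
  using assms by (auto simp: erases_def here_sat_def)

lemma here_sat_erases_true:
  assumes "erases a r' r" "a \<notin> X" "a \<notin> Y"
  shows "here_sat (insert a X) (insert a Y) r' \<longleftrightarrow>
    a |\<in>| head r' \<or> a |\<in>| neg_body r' \<or> here_sat X Y r"
  using assms by (auto simp: erases_def here_sat_def)

lemma ht_model_unerase:
  assumes P: "rel_set (erases a) P' P" and Q: "rel_set (erases a) Q' Q"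
    and disj: "\<And>r. r \<in> Q' \<Longrightarrow> fset (pos_body r) \<inter> (fset (head r) \<union> fset (neg_body r)) = {}"
    and c: "c True True" and a: "a \<notin> X" "a \<notin> Y"
    and XY: "ht_model c P X Y" "\<not> ht_model c Q X Y"
  obtains A where "A \<subseteq> {a}" "ht_model c P' (A \<union> X) (A \<union> Y)" "\<not> ht_model c Q' (A \<union> X) (A \<union> Y)"
proof -
  obtain r where r: "r \<in> Q" "\<not> c (here_sat Y Y r) (here_sat X Y r)"
    using XY(2) by (auto simp: ht_model_def)
  then obtain r' where r': "r' \<in> Q'" "erases a r' r"
    using Q by (auto simp: rel_set_def)
  have P_sat: "c (here_sat Y Y p) (here_sat X Y p)" if "p \<in> P" for p
    using XY(1) that by (simp add: ht_model_def)
  have P_erase: "\<exists>p\<in>P. erases a p' p" if "p' \<in> P'" for p'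
    using P that by (auto simp: rel_set_def)
  show thesis
  proof (cases "a |\<in>| pos_body r'")
    case False
    \<comment> \<open>If \<open>a\<close> is in the positive body of \<open>p'\<close>, both
      arguments are true and \<open>c True True\<close> applies; otherwise they are those of
      \<open>p\<close>.\<close>
    have "c (here_sat Y Y p') (here_sat X Y p')" if "p' \<in> P'" for p'
    proof -
      obtain p where "p \<in> P" "erases a p' p" using P_erase \<open>p' \<in> P'\<close> by blast
      then show ?thesis
        using P_sat[of p] c a by (cases "a |\<in>| pos_body p'") (simp_all add: here_sat_erases_false)
    qed
    moreover have "\<not> c (here_sat Y Y r') (here_sat X Y r')"
      using r r' a False by (simp add: here_sat_erases_false)
    ultimately show thesis
      using that[of "{}"] r'(1) by (auto simp: ht_model_def)
  next
    case True
    then have notin: "a |\<notin>| head r'" "a |\<notin>| neg_body r'"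
      using disj[OF r'(1)] by auto
    let ?X = "insert a X" and ?Y = "insert a Y"
    have "c (here_sat ?Y ?Y p') (here_sat ?X ?Y p')" if "p' \<in> P'" for p'
    proof -
      obtain p where "p \<in> P" "erases a p' p" using P_erase \<open>p' \<in> P'\<close> by blast
      then show ?thesis
        using P_sat[of p] c a
        by (cases "a |\<in>| head p' \<or> a |\<in>| neg_body p'") (auto simp: here_sat_erases_true)
    qed
    moreover have "\<not> c (here_sat ?Y ?Y r') (here_sat ?X ?Y r')"
      using r r' a notin by (simp add: here_sat_erases_true)
    ultimately show thesis
      using that[of "{a}"] r'(1) by (auto simp: ht_model_def)
  qed
qed

lemma add_atom_erases:
  assumes "a \<notin> atoms_of T"
  shows "list_all2 (erases a) (add_atom a N T) T"
proof (rule list_all2_all_nthI)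
  fix i assume "i < length (add_atom a N T)"
  then have i: "i < length T" by (simp add: length_add_atom)
  then have "a \<notin> fset (head (T ! i)) \<union> fset (pos_body (T ! i)) \<union> fset (neg_body (T ! i))"
    using assms nth_mem[OF i] unfolding atoms_of_def by blast
  then show "erases a (add_atom a N T ! i) (T ! i)"
    using i by (auto simp: erases_def add_atom_def)
qed (simp add: length_add_atom)

lemma list_all2_imp_rel_set: "list_all2 R xs ys \<Longrightarrow> rel_set R (set xs) (set ys)"
  by (rule rel_funD[OF list.set_transfer])

lemma ht_equiv_unerase:
  fixes P Q :: "'a rule list"
  assumes fresh: "a \<notin> atoms_of (P @ Q)"
    and rel: "rel_set (erases a) P' (set P)" "rel_set (erases a) Q' (set Q)"
    and disj: "\<And>r. r \<in> P' \<union> Q' \<Longrightarrow> fset (pos_body r) \<inter> (fset (head r) \<union> fset (neg_body r)) = {}"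
    and c: "c True True"
    and eq: "\<And>X Y. X \<subseteq> Y \<Longrightarrow> finite Y \<Longrightarrow> ht_model c P' X Y = ht_model c Q' X Y"
  shows "ht_equiv c (set P) (set Q)"
  unfolding ht_equiv_def
proof (intro allI impI)
  fix X Y :: "'a set" assume "X \<subseteq> Y"
  define A where "A = atoms_of (P @ Q)"
  \<comment> \<open>Intersecting with \<open>A\<close> makes \<open>V\<close> finite and free of
    \<open>a\<close>, so \<open>eq\<close> applies with or without \<open>a\<close> added.\<close>
  define U V where "U = X \<inter> A" and "V = Y \<inter> A"
  have UV: "U \<subseteq> V" "finite V" "a \<notin> U" "a \<notin> V"
    using \<open>X \<subseteq> Y\<close> fresh finite_atoms_of[of "P @ Q"] by (auto simp: U_def V_def A_def)
  have eqUV: "ht_model c P' (B \<union> U) (B \<union> V) = ht_model c Q' (B \<union> U) (B \<union> V)" if "B \<subseteq> {a}" for B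
    using that UV finite_subset[OF that] by (intro eq) auto
  have "ht_model c (set P) U V = ht_model c (set Q) U V"
  proof (rule ccontr)
    assume "ht_model c (set P) U V \<noteq> ht_model c (set Q) U V"
    then consider "ht_model c (set P) U V" "\<not> ht_model c (set Q) U V"
      | "ht_model c (set Q) U V" "\<not> ht_model c (set P) U V" by blast
    then show False
    proof cases
      case 1
      show False
        by (rule ht_model_unerase[OF rel disj c UV(3,4) 1]) (use eqUV in auto)
    next
      case 2
      show False
        by (rule ht_model_unerase[OF rel(2,1) disj c UV(3,4) 2]) (use eqUV in auto)
    qed
  qed
  moreover have "atoms_of P \<subseteq> A" "atoms_of Q \<subseteq> A"
    by (auto simp: A_def atoms_of_def)
  ultimately show "ht_model c (set P) X Y = ht_model c (set Q) X Y"
    by (simp add: U_def V_def ht_model_restrict)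
qed

theorem theorem9:
  fixes eqv :: "'a rule set \<Rightarrow> 'a rule set \<Rightarrow> bool"
    and P Q Pplus Qplus :: "'a rule list" and N :: "nat set" and a' :: 'a
  assumes "eqv = strongly_equiv_asp \<or> eqv = strongly_equiv_lpmln"
    and "nsv_tuple (P @ Q)"
    and "N \<noteq> {}" and "N \<subseteq> {..<3 * length (P @ Q)}"
    and "a' \<notin> atoms_of (P @ Q)"
    and "Pplus = take (length P) (add_atom a' N (P @ Q))"
    and "Qplus = drop (length P) (add_atom a' N (P @ Q))"
    and "nsv_tuple (Pplus @ Qplus)"
  shows "(\<not> eqv (set P) (set Q) \<longrightarrow> \<not> eqv (set Pplus) (set Qplus)) \<and>
         (eqv (set Pplus) (set Qplus) \<longrightarrow> eqv (set P) (set Q))"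
proof -
  \<comment> \<open>Positions in \<open>N\<close> run through the whole tuple, so the relation is
    obtained for \<open>P @ Q\<close> and then split.\<close>
  note erase = add_atom_erases[OF assms(5), of N]
  have "list_all2 (erases a') Pplus P" "list_all2 (erases a') Qplus Q"
    using list_all2_takeI[OF erase, of "length P"] list_all2_dropI[OF erase, of "length P"] assms(6,7)
    by simp_all
  then have rel: "rel_set (erases a') (set Pplus) (set P)" "rel_set (erases a') (set Qplus) (set Q)"
    by (auto intro: list_all2_imp_rel_set)
  have disj: "fset (pos_body r) \<inter> (fset (head r) \<union> fset (neg_body r)) = {}"
    if "r \<in> set Pplus \<union> set Qplus" for r
    using assms(8) that by (simp add: nsv_tuple_def)
  have "eqv (set P) (set Q)" if "eqv (set Pplus) (set Qplus)"
    using assms(1)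
  proof
    assume eqv: "eqv = strongly_equiv_asp"
    have "ht_equiv (\<and>) (set P) (set Q)"
      by (rule ht_equiv_unerase[OF assms(5) rel disj])
        (use strongly_equiv_asp_imp_ht_model_eq[OF that[unfolded eqv]] in auto)
    then show ?thesis unfolding eqv by (rule ht_equiv_imp_strongly_equiv_asp)
  next
    assume eqv: "eqv = strongly_equiv_lpmln"
    have "ht_equiv (\<longrightarrow>) (set P) (set Q)"
      by (rule ht_equiv_unerase[OF assms(5) rel disj])
        (use strongly_equiv_lpmln_imp_ht_model_eq[OF that[unfolded eqv]] in auto)
    then show ?thesis unfolding eqv by (rule ht_equiv_imp_strongly_equiv_lpmln)
  qed
  then show ?thesis by blast
qed

end
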